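(* Fix positive integers $d$ and $|T|$, and allow the number of voters and the set of candidates to vary. Every profile with horizon $|T|$ and at most $d$ first choices per round admits a sequence satisfying all-rank-PJR if and only if $|T|=1$ or $d\le3$. The same characterization holds for all-rank-wPJR. In the positive cases, a polynomial-time semi-online rule suffices. For every $|T|\ge2$, the negative case holds on a static profile with four candidates and $n=2|T|$ voters (i.e., there is such a profile for which no sequence satisfies all-rank-wPJR).
   Context: Model. Voters $V=[n]$, a set $C$ of $m$ candidates, rounds $T=\{1,\dots,|T|\}$ with $n,m,|T|\ge1$; $|T|$ is the horizon. In each round $j$ each voter $i$ has a strict complete ranking of $C$; her most-preferred candidate is her first choice in round $j$. A profile consists of all rankings and is static if they are the same in all rounds. "At most $d$ first choices per round" means that in every round at most $d$ distinct candidates are the first choice of some voter. For $r\in[m]$, $A_i^j(r)$ is the set of voter $i$'s $r$ most-preferred candidates in round $j$. A sequence is $W=(w^1,\dots,w^{|T|})\in C^{|T|}$. A group is a nonempty $S\subseteq V$. A rule is semi-online if each $w^j$ depends only on the rankings in rounds $1,\dots,j$ and on $|T|$. All-rank axioms. A rank matrix is $R=(r_i^j)\in[m]^{|T|\times n}$. Under $R$, a group $S$ agrees in round $j$ if $\bigcap_{i\in S}A_i^j(r_i^j)\ne\varnothing$, and is represented in round $j$ if $w^j\in\bigcup_{i\in S}A_i^j(r_i^j)$. $W$ satisfies all-rank-PJR if, for every rank matrix $R$, every group $S$ that agrees in $k>0$ rounds under $R$ is represented in at least $\lfloor k|S|/n\rfloor$ rounds. All-rank-wPJR is this requirement restricted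 to groups agreeing in every round ($k=|T|$). *)

theory Defs
  imports "HOL-Combinatorics.Multiset_Permutations"
begin

section \<open>Profiles, sequences and rules\<close>

text \<open>
  Voters are \<open>{1..n}\<close> and rounds are \<open>{1..T}\<close>.  A strict complete ranking of \<open>C\<close> is a list
  enumerating \<open>C\<close> without repetition, most-preferred candidate first; \<open>P j i\<close> is the ranking of
  voter \<open>i\<close> in round \<open>j\<close>.  Values of \<open>P\<close> outside these index ranges are irrelevant.
\<close>

type_synonym 'c profile = "nat \<Rightarrow> nat \<Rightarrow> 'c list"

definition is_profile :: "nat \<Rightarrow> 'c set \<Rightarrow> nat \<Rightarrow> 'c profile \<Rightarrow> bool" where
  "is_profile n C T P \<longleftrightarrow> n \<ge> 1 \<and> T \<ge> 1 \<and> finite C \<and> C \<noteq> {} \<and>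
     (\<forall>j\<in>{1..T}. \<forall>i\<in>{1..n}. P j i \<in> permutations_of_set C)"

definition static :: "nat \<Rightarrow> nat \<Rightarrow> 'c profile \<Rightarrow> bool" where
  "static n T P \<longleftrightarrow> (\<forall>i\<in>{1..n}. \<forall>j\<in>{1..T}. \<forall>j'\<in>{1..T}. P j i = P j' i)"

definition first_choices :: "nat \<Rightarrow> 'c profile \<Rightarrow> nat \<Rightarrow> 'c set" where
  "first_choices n P j = (\<lambda>i. hd (P j i)) ` {1..n}"

definition at_most_first_choices :: "nat \<Rightarrow> nat \<Rightarrow> nat \<Rightarrow> 'c profile \<Rightarrow> bool" where
  "at_most_first_choices d n T P \<longleftrightarrow> (\<forall>j\<in>{1..T}. card (first_choices n P j) \<le> d)"

definition sequences :: "'c set \<Rightarrow> nat \<Rightarrow> (nat \<Rightarrow> 'c) set" where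
  "sequences C T = {W. \<forall>j\<in>{1..T}. W j \<in> C}"

definition top_set :: "'c profile \<Rightarrow> nat \<Rightarrow> nat \<Rightarrow> nat \<Rightarrow> 'c set" where
  "top_set P j i r = set (take r (P j i))"

text \<open>A rule maps the number of voters, the candidates, the horizon and a profile to a sequence.\<close>

type_synonym 'c rule = "nat \<Rightarrow> 'c set \<Rightarrow> nat \<Rightarrow> 'c profile \<Rightarrow> nat \<Rightarrow> 'c"

definition is_rule :: "'c rule \<Rightarrow> bool" where
  "is_rule F \<longleftrightarrow> (\<forall>n C T P. is_profile n C T P \<longrightarrow> F n C T P \<in> sequences C T)"

definition semi_online :: "'c rule \<Rightarrow> bool" where
  "semi_online F \<longleftrightarrow> (\<forall>n C T P P'. is_profile n C T P \<longrightarrow> is_profile n C T P' \<longrightarrow>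
     (\<forall>j\<in>{1..T}. (\<forall>l\<in>{1..j}. \<forall>i\<in>{1..n}. P l i = P' l i) \<longrightarrow> F n C T P j = F n C T P' j))"


section \<open>All-rank axioms\<close>

text \<open>The entry \<open>R j i\<close> of a rank matrix is the rank of voter \<open>i\<close> in round \<open>j\<close>.\<close>

definition rank_matrices :: "nat \<Rightarrow> nat \<Rightarrow> nat \<Rightarrow> (nat \<Rightarrow> nat \<Rightarrow> nat) set" where
  "rank_matrices n m T = {R. \<forall>j\<in>{1..T}. \<forall>i\<in>{1..n}. R j i \<in> {1..m}}"

definition agrees :: "'c profile \<Rightarrow> (nat \<Rightarrow> nat \<Rightarrow> nat) \<Rightarrow> nat set \<Rightarrow> nat \<Rightarrow> bool" where
  "agrees P R S j \<longleftrightarrow> (\<Inter>i\<in>S. top_set P j i (R j i)) \<noteq> {}"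

definition represented ::
  "'c profile \<Rightarrow> (nat \<Rightarrow> nat \<Rightarrow> nat) \<Rightarrow> (nat \<Rightarrow> 'c) \<Rightarrow> nat set \<Rightarrow> nat \<Rightarrow> bool" where
  "represented P R W S j \<longleftrightarrow> W j \<in> (\<Union>i\<in>S. top_set P j i (R j i))"

definition all_rank_PJR :: "nat \<Rightarrow> 'c set \<Rightarrow> nat \<Rightarrow> 'c profile \<Rightarrow> (nat \<Rightarrow> 'c) \<Rightarrow> bool" where
  "all_rank_PJR n C T P W \<longleftrightarrow>
     (\<forall>R\<in>rank_matrices n (card C) T. \<forall>S k. S \<noteq> {} \<longrightarrow> S \<subseteq> {1..n} \<longrightarrow>
        k = card {j\<in>{1..T}. agrees P R S j} \<longrightarrow> k > 0 \<longrightarrow>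
        card {j\<in>{1..T}. represented P R W S j} \<ge> (k * card S) div n)"

definition all_rank_wPJR :: "nat \<Rightarrow> 'c set \<Rightarrow> nat \<Rightarrow> 'c profile \<Rightarrow> (nat \<Rightarrow> 'c) \<Rightarrow> bool" where
  "all_rank_wPJR n C T P W \<longleftrightarrow>
     (\<forall>R\<in>rank_matrices n (card C) T. \<forall>S. S \<noteq> {} \<longrightarrow> S \<subseteq> {1..n} \<longrightarrow>
        (\<forall>j\<in>{1..T}. agrees P R S j) \<longrightarrow>
        card {j\<in>{1..T}. represented P R W S j} \<ge> (T * card S) div n)"


section \<open>Polynomial time\<close>

text \<open>
  The machine model is a structured random access machine with finitely many arrays of natural
  numbers per program.  Every assignment and every test costs one step.  The only arithmetic is
  addition and truncated subtraction, so the bit lengths of stored numbers grow by at most a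
  constant (depending on the program) per step; hence polynomially many steps amount to polynomial
  time on a Turing machine.  Multiplication is deliberately not primitive, as it would break this
  equivalence under unit cost.
\<close>

type_synonym store = "nat \<Rightarrow> nat \<Rightarrow> nat"

datatype expr = Num nat | Read nat expr | Plus expr expr | Minus expr expr

primrec val :: "store \<Rightarrow> expr \<Rightarrow> nat" where
  "val s (Num k) = k"
| "val s (Read x e) = s x (val s e)"
| "val s (Plus e1 e2) = val s e1 + val s e2"
| "val s (Minus e1 e2) = val s e1 - val s e2"

text \<open>\<open>Assign x e1 e2\<close> is \<open>x[e1] := e2\<close>; a test succeeds if its value is nonzero.\<close>

datatype com = Skip | Assign nat expr expr | Seq com com | Cond expr com com | While expr com

inductive exec :: "com \<Rightarrow> store \<Rightarrow> nat \<Rightarrow> store \<Rightarrow> bool" where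
  "exec Skip s 1 s"
| "exec (Assign x e1 e2) s 1 (s(x := (s x)(val s e1 := val s e2)))"
| "exec c1 s t1 s' \<Longrightarrow> exec c2 s' t2 s'' \<Longrightarrow> exec (Seq c1 c2) s (t1 + t2) s''"
| "val s e \<noteq> 0 \<Longrightarrow> exec c1 s t s' \<Longrightarrow> exec (Cond e c1 c2) s (t + 1) s'"
| "val s e = 0 \<Longrightarrow> exec c2 s t s' \<Longrightarrow> exec (Cond e c1 c2) s (t + 1) s'"
| "val s e = 0 \<Longrightarrow> exec (While e c) s 1 s"
| "val s e \<noteq> 0 \<Longrightarrow> exec c s t1 s' \<Longrightarrow> exec (While e c) s' t2 s'' \<Longrightarrow>
     exec (While e c) s (t1 + t2 + 1) s''"

text \<open>
  Input: arrays 0, 1, 2 hold \<open>n\<close>, \<open>m = card C\<close> and \<open>T\<close> at index 0, and array 3 holds the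
  \<open>T * n * m\<close> entries of the rankings, ordered by round, then voter, then rank.  All other cells
  are 0.  Output: cell \<open>j\<close> of array 4 is the candidate of round \<open>j\<close>.
\<close>

definition ranking_table :: "nat \<Rightarrow> nat \<Rightarrow> nat profile \<Rightarrow> nat list" where
  "ranking_table n T P = concat (map (\<lambda>j. concat (map (\<lambda>i. P j i) [1..<n + 1])) [1..<T + 1])"

definition input_store :: "nat \<Rightarrow> nat set \<Rightarrow> nat \<Rightarrow> nat profile \<Rightarrow> store" where
  "input_store n C T P = (\<lambda>x a.
     if x = 0 \<and> a = 0 then n
     else if x = 1 \<and> a = 0 then card C
     else if x = 2 \<and> a = 0 then T
     else if x = 3 \<and> a < length (ranking_table n T P) then ranking_table n T P ! a
     else 0)"

definition polynomial_time :: "nat rule \<Rightarrow> bool" where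
  "polynomial_time F \<longleftrightarrow> (\<exists>prog a b. \<forall>n C T P. is_profile n C T P \<longrightarrow>
     (\<exists>t s. exec prog (input_store n C T P) t s \<and> t \<le> a * (n * card C * T) ^ b \<and>
        (\<forall>j\<in>{1..T}. s 4 j = F n C T P j)))"

end

theory Submission
  imports Defs
begin

text \<open>
  Give every voter a budget of \<open>T\<close> and charge \<open>n\<close> per round to the supporters of the winner, who is
  the first choice with the largest total remaining budget.  A winner \<open>w\<close> is \<^emph>\<open>hit\<close> by a group if it
  is the first choice of a member; only hitting groups pay, so a group \<open>S\<close> that ends with budget less
  than \<open>n\<close> hits at least \<open>T * card S div n\<close> winners.  With at most three first choices per round,
  every winner can pay in full while at least three rounds remain.  When two rounds remain, the total
  budget is \<open>2 * n\<close>, and a group hitting neither of the last two winners owns at most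
  \<open>8/9 * n\<close> of it (a third is lost with the first winner and a third of the rest with the second).
  Cohesion of \<open>S\<close> is thus irrelevant.

  For the negative part, let four types of voters have the cyclic rankings \<open>0123\<close>, \<open>1230\<close>, \<open>2301\<close>,
  \<open>3012\<close>, with \<open>2 * T - 3\<close>, 1, 1, 1 voters.  All types but \<open>w\<close> prefer the predecessor of \<open>w\<close> to
  \<open>w\<close>, so a union of types is represented only by its own first choices.  For unions of two types
  the axiom forces any two candidates to win together exactly half as often as they have supporters,
  hence each candidate too, which is impossible because the supports are odd.
\<close>

section \<open>The greedy budget rule\<close>

definition support :: "nat \<Rightarrow> (nat \<Rightarrow> 'c) \<Rightarrow> (nat \<Rightarrow> nat) \<Rightarrow> 'c \<Rightarrow> nat" where
  "support k f b c = (\<Sum>i = 1..k. if f i = c then b i else 0)"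

text \<open>The scan runs over voters, so candidates need no order and each step is one pass of a
  program loop. Ties keep the earlier leader; the base value \<open>f 1\<close> keeps the leader a
  first choice.\<close>

primrec leader :: "nat \<Rightarrow> (nat \<Rightarrow> 'c) \<Rightarrow> (nat \<Rightarrow> nat) \<Rightarrow> nat \<Rightarrow> 'c" where
  "leader n f b 0 = f 1"
| "leader n f b (Suc k) =
     (if support n f b (leader n f b k) < support n f b (f (Suc k)) then f (Suc k) else leader n f b k)"

text \<open>
  The supporters of \<open>w\<close> pay in the order of their indices; truncated subtraction makes each of them
  pay the minimum of her budget and the part of the price \<open>n\<close> that is still missing.
\<close>

definition charge :: "nat \<Rightarrow> (nat \<Rightarrow> 'c) \<Rightarrow> (nat \<Rightarrow> nat) \<Rightarrow> 'c \<Rightarrow> nat \<Rightarrow> nat" where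
  "charge n f b w i = (if f i = w then b i - (n - support (i - 1) f b w) else b i)"

primrec budget :: "nat \<Rightarrow> nat \<Rightarrow> (nat \<Rightarrow> nat \<Rightarrow> 'c) \<Rightarrow> nat \<Rightarrow> nat \<Rightarrow> nat" where
  "budget n T f 0 = (\<lambda>i. T)"
| "budget n T f (Suc j) =
     charge n (f (Suc j)) (budget n T f j) (leader n (f (Suc j)) (budget n T f j) n)"

declare budget.simps(2) [simp del]

definition greedy :: "nat \<Rightarrow> nat \<Rightarrow> (nat \<Rightarrow> nat \<Rightarrow> 'c) \<Rightarrow> nat \<Rightarrow> 'c" where
  "greedy n T f j = leader n (f j) (budget n T f (j - 1)) n"

section \<open>Supports, leaders and charges, and their dependence on past rounds only\<close>

lemma support_0 [simp]: "support 0 f b c = 0"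
  by (simp add: support_def)

lemma support_Suc [simp]:
  "support (Suc k) f b c = support k f b c + (if f (Suc k) = c then b (Suc k) else 0)"
  by (simp add: support_def)

lemma support_cong:
  assumes "\<And>i. i \<in> {1..k} \<Longrightarrow> f i = f' i" "\<And>i. i \<in> {1..k} \<Longrightarrow> b i = b' i"
  shows "support k f b c = support k f' b' c"
  unfolding support_def using assms by (intro sum.cong) auto

lemma support_eq: "support n f b c = sum b {i \<in> {1..n}. f i = c}"
  by (simp only: support_def sum.inter_filter[OF finite_atLeastAtMost])

lemma leader_mem: "n \<ge> 1 \<Longrightarrow> k \<le> n \<Longrightarrow> leader n f b k \<in> f ` {1..n}"
  by (induction k) auto

lemma support_le_leader:
  "i \<in> {1..k} \<Longrightarrow> support n f b (f i) \<le> support n f b (leader n f b k)"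
  by (induction k) (auto simp: le_Suc_eq)

lemma leader_cong:
  assumes "n \<ge> 1" "k \<le> n"
    and "\<And>i. i \<in> {1..n} \<Longrightarrow> f i = f' i" "\<And>i. i \<in> {1..n} \<Longrightarrow> b i = b' i"
  shows "leader n f b k = leader n f' b' k"
  using assms(2)
proof (induction k)
  case (Suc k)
  have "support n f b = support n f' b'"
    using assms(3,4) by (intro ext support_cong) auto
  with Suc assms(3)[of "Suc k"] show ?case by simp
qed (use assms in auto)

lemma charge_le: "charge n f b w i \<le> b i"
  by (simp add: charge_def)

text \<open>Within every prefix of voters the supporters jointly pay the minimum of \<open>n\<close>
  and their support: for prefix support \<open>s\<close> and next budget \<open>b\<close>, truncated
  subtraction satisfies \<open>(s - n) + (b - (n - s)) = (s + b) - n\<close>.\<close>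

lemma support_charge: "support k f (charge n f b w) w = support k f b w - n"
  by (induction k) (auto simp: charge_def)

lemma budget_cong:
  assumes "n \<ge> 1" "\<And>l i. l \<in> {1..j} \<Longrightarrow> i \<in> {1..n} \<Longrightarrow> f l i = f' l i" "i \<in> {1..n}"
  shows "budget n T f j i = budget n T f' j i"
  using assms(2,3)
proof (induction j arbitrary: i)
  case (Suc j)
  have IH: "budget n T f j i = budget n T f' j i" if "i \<in> {1..n}" for i
    using Suc.prems(1) that by (intro Suc.IH) auto
  have w: "leader n (f (Suc j)) (budget n T f j) n = leader n (f' (Suc j)) (budget n T f' j) n"
    using assms(1) Suc.prems(1)[of "Suc j"] IH by (intro leader_cong) auto
  have "support (i - 1) (f (Suc j)) (budget n T f j) c
      = support (i - 1) (f' (Suc j)) (budget n T f' j) c" for c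
    using Suc.prems IH by (intro support_cong) auto
  with Suc.prems IH w show ?case by (simp add: charge_def budget.simps(2))
qed simp

lemma greedy_cong:
  assumes "n \<ge> 1" "j \<ge> 1" "\<And>l i. l \<in> {1..j} \<Longrightarrow> i \<in> {1..n} \<Longrightarrow> f l i = f' l i"
  shows "greedy n T f j = greedy n T f' j"
  unfolding greedy_def using assms by (intro leader_cong budget_cong) auto

lemma greedy_mem: "n \<ge> 1 \<Longrightarrow> greedy n T f j \<in> f j ` {1..n}"
  unfolding greedy_def by (rule leader_mem) simp_all

lemma budget_Suc:
  "budget n T f (Suc j) = charge n (f (Suc j)) (budget n T f j) (greedy n T f (Suc j))"
  by (simp add: greedy_def budget.simps(2))

section \<open>Hits of a group against its remaining budget\<close>

definition hits :: "nat \<Rightarrow> nat \<Rightarrow> (nat \<Rightarrow> nat \<Rightarrow> 'c) \<Rightarrow> nat set \<Rightarrow> nat \<Rightarrow> nat" where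
  "hits n T f S j = card {l \<in> {1..j}. greedy n T f l \<in> f l ` S}"

lemma hits_0 [simp]: "hits n T f S 0 = 0"
  by (simp add: hits_def)

lemma hits_Suc [simp]:
  "hits n T f S (Suc j) = hits n T f S j + (if greedy n T f (Suc j) \<in> f (Suc j) ` S then 1 else 0)"
proof -
  have "{l \<in> {1..Suc j}. greedy n T f l \<in> f l ` S} =
    (if greedy n T f (Suc j) \<in> f (Suc j) ` S then insert (Suc j) else id)
      {l \<in> {1..j}. greedy n T f l \<in> f l ` S}"
    by (auto simp: le_Suc_eq)
  then show ?thesis by (simp add: hits_def)
qed

lemma budget_unhit:
  "greedy n T f (Suc j) \<notin> f (Suc j) ` S \<Longrightarrow> sum (budget n T f (Suc j)) S = sum (budget n T f j) S"
  unfolding budget_Suc by (intro sum.cong) (auto simp: charge_def image_iff)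

text \<open>Only supporters of \<open>w\<close> pay, and by \<open>support_charge\<close> their
  payments add up to \<open>min n (support n f b w)\<close>; the members of \<open>S\<close> pay a
  part of this.\<close>

lemma charge_sum:
  assumes "S \<subseteq> {1..n}"
  shows "sum b S \<le> sum (charge n f b w) S + min n (support n f b w)"
proof -
  let ?p = "{i \<in> {1..n}. f i = w}"
  have fin: "finite S" "finite ?p" using assms finite_subset by auto
  have "sum b S = sum (charge n f b w) S + sum (\<lambda>i. b i - charge n f b w i) S"
    by (simp add: sum.distrib[symmetric] charge_le)
  also have "sum (\<lambda>i. b i - charge n f b w i) S \<le> sum (\<lambda>i. b i - charge n f b w i) ?p"
  proof -
    have "sum (\<lambda>i. b i - charge n f b w i) S = sum (\<lambda>i. b i - charge n f b w i) (S \<inter> ?p)"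
      using assms fin by (intro sum.mono_neutral_right) (auto simp: charge_def)
    also have "\<dots> \<le> sum (\<lambda>i. b i - charge n f b w i) ?p"
      using fin by (intro sum_mono2) auto
    finally show ?thesis .
  qed
  also have "sum (\<lambda>i. b i - charge n f b w i) ?p = sum b ?p - sum (charge n f b w) ?p"
    by (intro sum_subtractf_nat) (simp add: charge_le)
  also have "\<dots> = min n (support n f b w)"
    using support_charge[of n f n b w] by (simp add: support_eq min_def)
  finally show ?thesis by simp
qed

lemma charge_sum_all:
  "sum (charge n f b w) {1..n} + min n (support n f b w) = sum b {1..n}"
proof -
  let ?p = "{i \<in> {1..n}. f i = w}" and ?q = "{i \<in> {1..n}. f i \<noteq> w}"
  have *: "sum g {1..n} = sum g ?p + sum g ?q" for g :: "nat \<Rightarrow> nat"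
    by (subst sum.union_disjoint[symmetric]) (auto intro: sum.cong)
  have "sum (charge n f b w) ?q = sum b ?q"
    by (intro sum.cong) (auto simp: charge_def)
  with support_charge[of n f n b w] show ?thesis
    unfolding * support_eq by simp
qed

text \<open>A hit costs \<open>S\<close> at most \<open>n\<close> and any other round costs it
  nothing, so the right-hand side never falls below its initial value.\<close>

lemma budget_hits:
  assumes "S \<subseteq> {1..n}"
  shows "T * card S \<le> sum (budget n T f j) S + n * hits n T f S j"
proof (induction j)
  case (Suc j)
  show ?case
  proof (cases "greedy n T f (Suc j) \<in> f (Suc j) ` S")
    case True
    have "sum (budget n T f j) S \<le> sum (budget n T f (Suc j)) S + n"
      using charge_sum[OF assms] unfolding budget_Suc by (meson add_left_mono le_trans min.cobounded1)
    with Suc True show ?thesis by simp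
  next
    case False
    with Suc budget_unhit[OF False] show ?thesis by simp
  qed
qed simp

text \<open>Pigeonhole: the total is split among at most \<open>d\<close> candidates, none with more
  support than the leader.\<close>

lemma sum_le_card_times_support:
  assumes "card (f ` {1..n}) \<le> d" "n \<ge> 1"
  shows "sum b {1..n} \<le> d * support n f b (leader n f b n)"
proof -
  have "sum b {1..n} = (\<Sum>c\<in>f ` {1..n}. support n f b c)"
    unfolding support_eq by (rule sum.image_gen) simp
  also have "\<dots> \<le> (\<Sum>c\<in>f ` {1..n}. support n f b (leader n f b n))"
    by (intro sum_mono) (auto intro: support_le_leader)
  also have "\<dots> \<le> d * support n f b (leader n f b n)"
    using assms by simp
  finally show ?thesis .
qed

lemma sum_unhit:
  assumes "S \<subseteq> {1..n}" "w \<notin> f ` S"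
  shows "sum b S + support n f b w \<le> sum b {1..n}"
proof -
  have "sum b S + support n f b w = sum b (S \<union> {i \<in> {1..n}. f i = w})"
    unfolding support_eq using assms finite_subset[OF assms(1)]
    by (intro sum.union_disjoint[symmetric]) auto
  also have "\<dots> \<le> sum b {1..n}" using assms by (intro sum_mono2) auto
  finally show ?thesis .
qed

text \<open>While \<open>T - j \<ge> 3\<close> the total is at least \<open>3 * n\<close>, so the
  leader has support at least \<open>n\<close> and the full price is paid. The claim stops at
  \<open>j = T - 2\<close>, since a total of \<open>2 * n\<close> only guarantees two thirds of the
  price.\<close>

lemma budget_sum:
  assumes "n \<ge> 1" "\<And>j. j \<in> {1..T} \<Longrightarrow> card (f j ` {1..n}) \<le> 3" "j + 2 \<le> T"
  shows "sum (budget n T f j) {1..n} = (T - j) * n"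
  using assms(3)
proof (induction j)
  case (Suc j)
  let ?s = "support n (f (Suc j)) (budget n T f j) (greedy n T f (Suc j))"
  have "sum (budget n T f j) {1..n} \<le> 3 * ?s"
    unfolding greedy_def using assms Suc.prems by (simp add: sum_le_card_times_support del: One_nat_def)
  moreover have tot: "sum (budget n T f j) {1..n} = (T - j) * n" using Suc by simp
  moreover have "3 * n \<le> (T - j) * n" using Suc.prems by (intro mult_right_mono) auto
  ultimately have "min n ?s = n" by linarith
  with charge_sum_all[of n "f (Suc j)" "budget n T f j" "greedy n T f (Suc j)"] tot
  have "sum (budget n T f (Suc j)) {1..n} + n = (T - j) * n" unfolding budget_Suc by simp
  moreover have "T - j = Suc (T - Suc j)" using Suc.prems by simp
  then have "(T - j) * n = (T - Suc j) * n + n" by (simp only: mult_Suc add.commute)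
  ultimately show ?case by simp
qed simp

text \<open>\<open>budget_hits\<close> is applied after round \<open>T - 2\<close>. It then suffices
  that the budget of \<open>S\<close> at that time is less than \<open>n * (1 + h)\<close>, where
  \<open>h\<close> counts the hits in the last two rounds.\<close>

lemma greedy_hits:
  assumes n: "n \<ge> 1" and d: "\<And>j. j \<in> {1..T} \<Longrightarrow> card (f j ` {1..n}) \<le> 3"
    and T: "T \<ge> 2" and S: "S \<subseteq> {1..n}"
  shows "T * card S div n \<le> hits n T f S T"
proof -
  define J where "J = T - 2"
  have TJ: "T = Suc (Suc J)" using T by (simp add: J_def)
  let ?b0 = "budget n T f J" and ?b1 = "budget n T f (Suc J)"
  let ?V = "{1..n}"
  define s1 where "s1 = support n (f (Suc J)) ?b0 (greedy n T f (Suc J))"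
  define s2 where "s2 = support n (f T) ?b1 (greedy n T f T)"
  have V0: "sum ?b0 ?V = 2 * n" using budget_sum[of n T f J] n d TJ by simp
  have V1: "sum ?b1 ?V + min n s1 = 2 * n"
    using charge_sum_all[of n "f (Suc J)" ?b0 "greedy n T f (Suc J)"] V0
    unfolding budget_Suc s1_def by simp
  have s1: "2 * n \<le> 3 * s1"
    using sum_le_card_times_support[OF d n, of "Suc J" ?b0] V0 TJ by (simp add: s1_def greedy_def)
  have s2: "sum ?b1 ?V \<le> 3 * s2"
    using sum_le_card_times_support[OF d n, of T ?b1] TJ by (simp add: s2_def greedy_def)
  have hits: "hits n T f S T = hits n T f S J
      + (if greedy n T f (Suc J) \<in> f (Suc J) ` S then 1 else 0)
      + (if greedy n T f T \<in> f T ` S then 1 else 0)"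
    unfolding TJ by simp
  have unhit1: "sum ?b0 S + s1 \<le> 2 * n \<and> sum ?b1 S = sum ?b0 S"
    if "greedy n T f (Suc J) \<notin> f (Suc J) ` S"
    using sum_unhit[OF S that, of ?b0] budget_unhit[OF that] V0 by (simp add: s1_def)
  have unhit2: "sum ?b1 S + s2 \<le> sum ?b1 ?V \<and> sum ?b0 S + s2 \<le> 2 * n"
    if "greedy n T f T \<notin> f T ` S"
  proof -
    have *: "sum ?b1 S + s2 \<le> sum ?b1 ?V" using sum_unhit[OF S that, of ?b1] by (simp add: s2_def)
    \<comment> \<open>The supporters of the last winner lie outside \<open>S\<close> and hold
      \<open>s2\<close>; budgets only decrease, so the voters outside \<open>S\<close> held at least
      that much one round earlier.\<close>
    have "sum ?b1 (?V - S) \<le> sum ?b0 (?V - S)"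
      unfolding budget_Suc by (intro sum_mono charge_le)
    then show ?thesis
      using * V0 sum.subset_diff[OF S finite_atLeastAtMost, of ?b0]
        sum.subset_diff[OF S finite_atLeastAtMost, of ?b1] by linarith
  qed
  have le: "sum ?b0 S \<le> 2 * n" unfolding V0[symmetric] using S by (intro sum_mono2) auto
  define h where "h = (if greedy n T f (Suc J) \<in> f (Suc J) ` S then 1 else 0)
      + (if greedy n T f T \<in> f T ` S then 1 else 0 :: nat)"
  consider "greedy n T f (Suc J) \<in> f (Suc J) ` S" "greedy n T f T \<in> f T ` S" "h = 2"
    | "greedy n T f (Suc J) \<notin> f (Suc J) ` S" "greedy n T f T \<in> f T ` S" "h = 1"
    | "greedy n T f (Suc J) \<in> f (Suc J) ` S" "greedy n T f T \<notin> f T ` S" "h = 1"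
    | "greedy n T f (Suc J) \<notin> f (Suc J) ` S" "greedy n T f T \<notin> f T ` S" "h = 0"
    by (auto simp: h_def)
  \<comment> \<open>In the order of the cases, the budget of \<open>S\<close> is at most
    \<open>2 * n\<close>, \<open>4/3 * n\<close>, \<open>5/3 * n\<close> and
    \<open>8/9 * n\<close>.\<close>
  then have "sum ?b0 S < n * (1 + h)"
  proof cases
    case 1
    then show ?thesis using le n by simp
  next
    case 2
    then show ?thesis using unhit1 s1 n by simp
  next
    case 3
    then have "sum ?b0 S < 2 * n" using unhit2[OF 3(2)] s2 V1 n by linarith
    then show ?thesis using 3 by simp
  next
    case 4
    have "sum ?b0 S < n" using unhit1[OF 4(1)] unhit2[OF 4(2)] s1 s2 V1 n by linarith
    then show ?thesis using 4 by simp
  qed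
  then have "T * card S < n * (1 + h) + n * hits n T f S J"
    using budget_hits[OF S, of T f J] by linarith
  also have "\<dots> = (hits n T f S T + 1) * n"
    using hits unfolding h_def by (simp add: algebra_simps)
  finally show ?thesis using n by (simp add: less_mult_imp_div_less flip: less_Suc_eq_le)
qed

section \<open>From hits to all-rank-PJR for the greedy rule\<close>

lemma PJR_of_hits:
  assumes P: "is_profile n C T P"
    and hits: "\<And>S. S \<subseteq> {1..n} \<Longrightarrow> T * card S div n \<le> card {j \<in> {1..T}. W j \<in> (\<lambda>i. hd (P j i)) ` S}"
  shows "all_rank_PJR n C T P W"
  unfolding all_rank_PJR_def
proof (intro ballI allI impI)
  fix R S k
  assume R: "R \<in> rank_matrices n (card C) T" and S: "S \<subseteq> {1..n}"
    and k: "k = card {j \<in> {1..T}. agrees P R S j}"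
  have "k \<le> T" unfolding k using card_mono[OF finite_atLeastAtMost, of "{j \<in> {1..T}. agrees P R S j}" 1 T] by fastforce
  then have "k * card S div n \<le> T * card S div n" by (simp add: div_le_mono)
  also have "\<dots> \<le> card {j \<in> {1..T}. W j \<in> (\<lambda>i. hd (P j i)) ` S}" using hits[OF S] .
  also have "\<dots> \<le> card {j \<in> {1..T}. represented P R W S j}"
  proof (intro card_mono subsetI)
    fix j assume "j \<in> {j \<in> {1..T}. W j \<in> (\<lambda>i. hd (P j i)) ` S}"
    then obtain i where ij: "j \<in> {1..T}" "i \<in> S" "W j = hd (P j i)" by auto
    then have i: "i \<in> {1..n}" using S by auto
    have "P j i \<in> permutations_of_set C" using P ij i by (auto simp: is_profile_def)
    then have "P j i \<noteq> []" using P by (auto simp: is_profile_def permutations_of_set_def)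
    \<comment> \<open>A rank of at least 1 puts the first choice into \<open>top_set\<close>, so
      every hit is a representation.\<close>
    moreover have "R j i \<ge> 1" using R ij i by (auto simp: rank_matrices_def)
    ultimately have "W j \<in> top_set P j i (R j i)"
      using ij(3) by (cases "P j i"; cases "R j i") (auto simp: top_set_def)
    then show "j \<in> {j \<in> {1..T}. represented P R W S j}" using ij by (auto simp: represented_def)
  qed simp
  finally show "k * card S div n \<le> card {j \<in> {1..T}. represented P R W S j}" .
qed

lemma all_rank_PJR_imp_wPJR:
  assumes "T \<ge> 1" "all_rank_PJR n C T P W"
  shows "all_rank_wPJR n C T P W"
  unfolding all_rank_wPJR_def
proof (intro ballI allI impI)
  fix R S
  assume *: "R \<in> rank_matrices n (card C) T" "S \<noteq> {}" "S \<subseteq> {1..n}" "\<forall>j\<in>{1..T}. agrees P R S j"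
  then have "{j \<in> {1..T}. agrees P R S j} = {1..T}" by auto
  then have "T = card {j \<in> {1..T}. agrees P R S j}" by simp
  from assms(2)[unfolded all_rank_PJR_def, rule_format, OF *(1-3) this] assms(1)
  show "T * card S div n \<le> card {j \<in> {1..T}. represented P R W S j}" by simp
qed

definition greedy_rule :: "'c rule" where
  "greedy_rule n C T P = greedy n T (\<lambda>j i. hd (P j i))"

lemma hd_mem_profile:
  assumes "is_profile n C T P" "j \<in> {1..T}" "i \<in> {1..n}"
  shows "hd (P j i) \<in> C"
proof -
  have "C \<noteq> {}" "set (P j i) = C"
    using assms by (auto simp: is_profile_def permutations_of_set_def)
  then show ?thesis by (cases "P j i") auto
qed

lemma is_rule_greedy_rule: "is_rule greedy_rule"
  unfolding is_rule_def sequences_def greedy_rule_def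
proof (intro allI impI CollectI ballI)
  fix n T C j and P :: "'a profile"
  assume P: "is_profile n C T P" and j: "j \<in> {1..T}"
  then show "greedy n T (\<lambda>j i. hd (P j i)) j \<in> C"
    using greedy_mem[of n T "\<lambda>j i. hd (P j i)" j] hd_mem_profile[OF P j] by (auto simp: is_profile_def)
qed

lemma semi_online_greedy_rule: "semi_online greedy_rule"
  unfolding semi_online_def greedy_rule_def
  by (auto simp: is_profile_def intro!: greedy_cong)

lemma greedy_rule_PJR:
  assumes P: "is_profile n C T P" and d: "at_most_first_choices d n T P" and "T = 1 \<or> d \<le> 3"
  shows "all_rank_PJR n C T P (greedy_rule n C T P)"
proof (rule PJR_of_hits[OF P])
  fix S assume S: "S \<subseteq> {1..n}"
  let ?f = "\<lambda>j i. hd (P j i)"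
  have n: "n \<ge> 1" "T \<ge> 1" using P by (auto simp: is_profile_def)
  have "T * card S div n \<le> hits n T ?f S T"
  \<comment> \<open>With one round the quota is 0 unless \<open>S\<close> contains all voters, and
    then the winner is a first choice of a member for any \<open>d\<close>.\<close>
  proof (cases "T = 1")
    case True
    show ?thesis
    proof (cases "S = {1..n}")
      case True
      then show ?thesis using greedy_mem[OF n(1), of 1 ?f 1] n \<open>T = 1\<close> hits_Suc[of n 1 ?f S 0] by simp
    next
      case False
      then have "card S < n" using psubset_card_mono[of "{1..n}" S] S by auto
      then show ?thesis using True by simp
    qed
  next
    case False
    with assms(3) d have "card (?f j ` {1..n}) \<le> 3" if "j \<in> {1..T}" for j
      using that by (force simp: at_most_first_choices_def first_choices_def)
    then show ?thesis using greedy_hits[OF n(1) _ _ S, of T ?f] False n by simp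
  qed
  then show "T * card S div n \<le> card {j \<in> {1..T}. greedy_rule n C T P j \<in> (\<lambda>i. hd (P j i)) ` S}"
    by (simp add: hits_def greedy_rule_def)
qed

section \<open>Running time of the greedy budget rule\<close>

definition triple :: "(store \<Rightarrow> bool) \<Rightarrow> com \<Rightarrow> nat \<Rightarrow> (store \<Rightarrow> bool) \<Rightarrow> bool" where
  "triple A c t B \<longleftrightarrow> (\<forall>s. A s \<longrightarrow> (\<exists>u s'. exec c s u s' \<and> u \<le> t \<and> B s'))"

text \<open>The precondition \<open>False\<close> for loops makes \<open>wp\<close> usable on loop-free programs only.\<close>

primrec wp :: "com \<Rightarrow> (store \<Rightarrow> bool) \<Rightarrow> store \<Rightarrow> bool" where
  "wp Skip B s = B s"
| "wp (Assign x e1 e2) B s = B (s(x := (s x)(val s e1 := val s e2)))"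
| "wp (Seq c1 c2) B s = wp c1 (wp c2 B) s"
| "wp (Cond e c1 c2) B s = (if val s e \<noteq> 0 then wp c1 B s else wp c2 B s)"
| "wp (While e c) B s = False"

text \<open>An upper bound: a conditional is charged for both branches.\<close>

primrec cost :: "com \<Rightarrow> nat" where
  "cost Skip = 1"
| "cost (Assign x e1 e2) = 1"
| "cost (Seq c1 c2) = cost c1 + cost c2"
| "cost (Cond e c1 c2) = cost c1 + cost c2 + 1"
| "cost (While e c) = 0"

lemma exec_wp: "wp c B s \<Longrightarrow> \<exists>u s'. exec c s u s' \<and> u \<le> cost c \<and> B s'"
proof (induction c arbitrary: B s)
  case (Seq c1 c2)
  from Seq.prems obtain u1 s1 where 1: "exec c1 s u1 s1" "u1 \<le> cost c1" "wp c2 B s1"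
    using Seq.IH(1) by fastforce
  from Seq.IH(2)[OF 1(3)] obtain u2 s2 where "exec c2 s1 u2 s2" "u2 \<le> cost c2" "B s2" by blast
  with 1 show ?case
    by (intro exI[of _ "u1 + u2"] exI[of _ s2]) (auto intro: exec.intros)
next
  case (Cond e c1 c2)
  show ?case
  proof (cases "val s e = 0")
    case True
    with Cond obtain u s' where "exec c2 s u s'" "u \<le> cost c2" "B s'" by fastforce
    with True show ?thesis
      by (intro exI[of _ "u + 1"] exI[of _ s']) (auto intro: exec.intros[simplified])
  next
    case False
    with Cond obtain u s' where "exec c1 s u s'" "u \<le> cost c1" "B s'" by fastforce
    with False show ?thesis
      by (intro exI[of _ "u + 1"] exI[of _ s']) (auto intro: exec.intros[simplified])
  qed
qed (auto intro: exec.intros[simplified])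

lemma triple_wp: "(\<And>s. A s \<Longrightarrow> wp c B s) \<Longrightarrow> cost c \<le> t \<Longrightarrow> triple A c t B"
  unfolding triple_def using exec_wp order_trans by blast

lemma triple_seq: "triple A c1 t1 B \<Longrightarrow> triple B c2 t2 D \<Longrightarrow> triple A (Seq c1 c2) (t1 + t2) D"
  unfolding triple_def by (meson add_mono exec.intros(3))

lemma triple_weaken:
  "triple A c t B \<Longrightarrow> (\<And>s. A' s \<Longrightarrow> A s) \<Longrightarrow> (\<And>s. B s \<Longrightarrow> B' s) \<Longrightarrow> t \<le> t' \<Longrightarrow> triple A' c t' B'"
  unfolding triple_def by (meson order_trans)

abbreviation var :: "nat \<Rightarrow> expr" where
  "var x \<equiv> Read x (Num 0)"

text \<open>\<open>c\<close> is run with the cell \<open>x[0]\<close> equal to \<open>1, \<dots>, y[0]\<close>.\<close>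

definition count_loop :: "nat \<Rightarrow> nat \<Rightarrow> com \<Rightarrow> com" where
  "count_loop x y c = Seq (Assign x (Num 0) (Num 0))
     (While (Minus (var y) (var x)) (Seq (Assign x (Num 0) (Plus (var x) (Num 1))) c))"

text \<open>The test is nonzero exactly while \<open>k < N\<close>. Each of the remaining
  \<open>N - k\<close> iterations costs at most \<open>t\<close> plus one for its test, and the
  failing test costs one more; the induction descends from \<open>k = N\<close>.\<close>

lemma triple_while:
  assumes I: "\<And>k s. I k s \<Longrightarrow> s x 0 = k \<and> s y 0 = N"
    and c: "\<And>k. k < N \<Longrightarrow> triple (I k) c t (I (Suc k))"
  shows "k \<le> N \<Longrightarrow> triple (I k) (While (Minus (var y) (var x)) c) ((N - k) * (t + 1) + 1) (I N)"
proof (induction rule: inc_induct)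
  case base
  show ?case unfolding triple_def
    using I by (fastforce intro: exec.intros)
next
  case (step k)
  show ?case unfolding triple_def
  proof (intro allI impI)
    fix s assume s: "I k s"
    from c[OF step(2)] s obtain u1 s1 where 1: "exec c s u1 s1" "u1 \<le> t" "I (Suc k) s1"
      unfolding triple_def by blast
    from step.IH 1(3) obtain u2 s2 where 2: "exec (While (Minus (var y) (var x)) c) s1 u2 s2"
      "u2 \<le> (N - Suc k) * (t + 1) + 1" "I N s2"
      unfolding triple_def by blast
    have "val s (Minus (var y) (var x)) \<noteq> 0" using I[OF s] step(2) by simp
    from exec.intros(7)[OF this 1(1) 2(1)]
    have "exec (While (Minus (var y) (var x)) c) s (u1 + u2 + 1) s2" .
    moreover have "N - k = Suc (N - Suc k)" using step(2) by simp
    then have "(N - k) * (t + 1) = (N - Suc k) * (t + 1) + (t + 1)" by (simp only: mult_Suc add.commute)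
    ultimately show "\<exists>u s'. exec (While (Minus (var y) (var x)) c) s u s' \<and>
        u \<le> (N - k) * (t + 1) + 1 \<and> I N s'"
      using 1(2) 2(2,3) by (intro exI[of _ "u1 + u2 + 1"] exI[of _ s2]) auto
  qed
qed

text \<open>The summand 2 pays for resetting the counter and for the failing test; \<open>t\<close>
  includes the increment.\<close>

lemma triple_count_loop:
  assumes "\<And>k s. I k s \<Longrightarrow> s x 0 = k \<and> s y 0 = N"
    and "\<And>k. k < N \<Longrightarrow> triple (I k) (Seq (Assign x (Num 0) (Plus (var x) (Num 1))) c) t (I (Suc k))"
    and "\<And>s. A s \<Longrightarrow> I 0 (s(x := (s x)(0 := 0)))"
  shows "triple A (count_loop x y c) (N * (t + 1) + 2) (I N)"
proof -
  have "triple A (Assign x (Num 0) (Num 0)) 1 (I 0)"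
    using assms(3) by (intro triple_wp) auto
  moreover have "triple (I 0) (While (Minus (var y) (var x))
      (Seq (Assign x (Num 0) (Plus (var x) (Num 1))) c)) ((N - 0) * (t + 1) + 1) (I N)"
    using assms(1,2) by (intro triple_while) auto
  ultimately show ?thesis unfolding count_loop_def
    by (auto dest: triple_seq)
qed

text \<open>
  Arrays: 5 budgets, 6 support by candidate, 7 first choices by voter, 8 round, 9 position in the
  ranking table, 10 voter, 11 leader, 12 unpaid part of the price, 13 old budget of a paying voter.
\<close>

definition read_firsts :: com where
  "read_firsts = count_loop 10 0
     (Seq (Assign 7 (var 10) (Read 3 (var 9)))
     (Seq (Assign 9 (Num 0) (Plus (var 9) (var 1)))
          (Assign 6 (Read 7 (var 10)) (Num 0))))"

definition add_support :: com where
  "add_support = count_loop 10 0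
     (Assign 6 (Read 7 (var 10)) (Plus (Read 6 (Read 7 (var 10))) (Read 5 (var 10))))"

definition find_leader :: com where
  "find_leader = Seq (Assign 11 (Num 0) (Read 7 (Num 1)))
     (count_loop 10 0
       (Cond (Minus (Read 6 (Read 7 (var 10))) (Read 6 (var 11)))
         (Assign 11 (Num 0) (Read 7 (var 10))) Skip))"

text \<open>The two truncated differences add up to 0 only for equal candidates, so the test singles
  out non-supporters. Array 13 saves the budget, which is overwritten before the unpaid part of the
  price is updated.\<close>

definition charge_supporters :: com where
  "charge_supporters = Seq (Seq (Assign 4 (var 8) (var 11)) (Assign 12 (Num 0) (var 0)))
     (count_loop 10 0
       (Cond (Plus (Minus (Read 7 (var 10)) (var 11)) (Minus (var 11) (Read 7 (var 10))))
         Skip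
         (Seq (Assign 13 (Num 0) (Read 5 (var 10)))
         (Seq (Assign 5 (var 10) (Minus (Read 5 (var 10)) (var 12)))
              (Assign 12 (Num 0) (Minus (var 12) (var 13)))))))"

definition greedy_program :: com where
  "greedy_program = Seq (count_loop 10 0 (Assign 5 (var 10) (var 2)))
     (count_loop 8 2 (Seq read_firsts (Seq add_support (Seq find_leader charge_supporters))))"

section \<open>Correctness and cost of the program\<close>

locale greedy_run =
  fixes n m T :: nat and tab :: "nat \<Rightarrow> nat" and f :: "nat \<Rightarrow> nat \<Rightarrow> nat"
  assumes n: "n \<ge> 1" and T: "T \<ge> 1"
    and tab: "\<And>j k. j < T \<Longrightarrow> k < n \<Longrightarrow> tab ((j * n + k) * m) = f (Suc j) (Suc k)"
begin

text \<open>\<open>r\<close> is the current round, \<open>p\<close> the position in the table, and \<open>q\<close> the last round decided.\<close>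

definition env :: "nat \<Rightarrow> nat \<Rightarrow> nat \<Rightarrow> store \<Rightarrow> bool" where
  "env r p q s \<longleftrightarrow> s 0 0 = n \<and> s 1 0 = m \<and> s 2 0 = T \<and> s 3 = tab \<and> s 8 0 = r \<and> s 9 0 = p \<and>
     (\<forall>l\<in>{1..q}. s 4 l = greedy n T f l)"

lemma env_upd [simp]: "x \<notin> {0, 1, 2, 3, 4, 8, 9} \<Longrightarrow> env r p q (s(x := a)) = env r p q s"
  by (simp add: env_def)

lemma envD:
  "env r p q s \<Longrightarrow> s 0 0 = n" "env r p q s \<Longrightarrow> s (Suc 0) 0 = m" "env r p q s \<Longrightarrow> s 2 0 = T"
  "env r p q s \<Longrightarrow> s 3 = tab" "env r p q s \<Longrightarrow> s 8 0 = r" "env r p q s \<Longrightarrow> s 9 0 = p"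
  by (simp_all add: env_def)

definition round_start :: "nat \<Rightarrow> store \<Rightarrow> bool" where
  "round_start J s \<longleftrightarrow> env J (J * n * m) J s \<and> (\<forall>i\<in>{1..n}. s 5 i = budget n T f J i)"

context
  fixes J :: nat
  assumes J: "J < T"
begin

text \<open>Array 6 is reset at current first choices only and may keep old supports elsewhere;
  hence the invariants describe it at first choices only.\<close>

definition firsts_inv :: "nat \<Rightarrow> store \<Rightarrow> bool" where
  "firsts_inv k s \<longleftrightarrow> env (Suc J) ((J * n + k) * m) J s \<and> s 10 0 = k \<and>
     (\<forall>i\<in>{1..n}. s 5 i = budget n T f J i) \<and>
     (\<forall>i\<in>{1..k}. s 7 i = f (Suc J) i \<and> s 6 (f (Suc J) i) = 0)"

definition support_inv :: "nat \<Rightarrow> store \<Rightarrow> bool" where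
  "support_inv k s \<longleftrightarrow> env (Suc J) (Suc J * n * m) J s \<and> s 10 0 = k \<and>
     (\<forall>i\<in>{1..n}. s 5 i = budget n T f J i) \<and>
     (\<forall>i\<in>{1..n}. s 7 i = f (Suc J) i \<and>
        s 6 (f (Suc J) i) = support k (f (Suc J)) (budget n T f J) (f (Suc J) i))"

definition leader_inv :: "nat \<Rightarrow> store \<Rightarrow> bool" where
  "leader_inv k s \<longleftrightarrow> env (Suc J) (Suc J * n * m) J s \<and> s 10 0 = k \<and>
     (\<forall>i\<in>{1..n}. s 5 i = budget n T f J i) \<and>
     (\<forall>i\<in>{1..n}. s 7 i = f (Suc J) i \<and>
        s 6 (f (Suc J) i) = support n (f (Suc J)) (budget n T f J) (f (Suc J) i)) \<and>
     s 11 0 = leader n (f (Suc J)) (budget n T f J) k"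

text \<open>The winner is written to array 4 before this loop starts, so \<open>Suc J\<close> rounds
  are already decided.\<close>

definition charge_inv :: "nat \<Rightarrow> store \<Rightarrow> bool" where
  "charge_inv k s \<longleftrightarrow> env (Suc J) (Suc J * n * m) (Suc J) s \<and> s 10 0 = k \<and>
     (\<forall>i\<in>{1..n}. s 5 i = (if i \<le> k then budget n T f (Suc J) i else budget n T f J i)) \<and>
     (\<forall>i\<in>{1..n}. s 7 i = f (Suc J) i) \<and> s 11 0 = greedy n T f (Suc J) \<and>
     s 12 0 = n - support k (f (Suc J)) (budget n T f J) (greedy n T f (Suc J))"

lemma read_firsts:
  "triple (\<lambda>s. env (Suc J) (J * n * m) J s \<and> (\<forall>i\<in>{1..n}. s 5 i = budget n T f J i))
     read_firsts (n * (4 + 1) + 2) (firsts_inv n)"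
  unfolding read_firsts_def
proof (rule triple_count_loop[where I = firsts_inv])
  fix k assume k: "k < n"
  show "triple (firsts_inv k) (Seq (Assign 10 (Num 0) (Plus (var 10) (Num 1)))
     (Seq (Assign 7 (var 10) (Read 3 (var 9))) (Seq (Assign 9 (Num 0) (Plus (var 9) (var 1)))
       (Assign 6 (Read 7 (var 10)) (Num 0))))) 4 (firsts_inv (Suc k))"
    using tab[OF J k]
    by (intro triple_wp) (auto simp: firsts_inv_def env_def algebra_simps le_Suc_eq)
qed (auto simp: firsts_inv_def envD)

lemma add_support: "triple (firsts_inv n) add_support (n * (2 + 1) + 2) (support_inv n)"
  unfolding add_support_def
proof (rule triple_count_loop[where I = support_inv])
  fix k assume k: "k < n"
  show "triple (support_inv k) (Seq (Assign 10 (Num 0) (Plus (var 10) (Num 1)))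
     (Assign 6 (Read 7 (var 10)) (Plus (Read 6 (Read 7 (var 10))) (Read 5 (var 10)))))
     2 (support_inv (Suc k))"
    using k by (intro triple_wp) (auto simp: support_inv_def envD)
next
  fix s assume "firsts_inv n s"
  moreover have "(J * n + n) * m = Suc J * n * m" by (simp add: algebra_simps)
  ultimately show "support_inv 0 (s(10 := (s 10)(0 := 0)))"
    by (simp add: support_inv_def firsts_inv_def del: mult_Suc)
qed (auto simp: support_inv_def envD)

lemma find_leader: "triple (support_inv n) find_leader (1 + (n * (4 + 1) + 2)) (leader_inv n)"
  unfolding find_leader_def
proof (rule triple_seq)
  let ?A = "\<lambda>s. support_inv n s \<and> s 11 0 = f (Suc J) 1"
  show "triple (support_inv n) (Assign 11 (Num 0) (Read 7 (Num 1))) 1 ?A"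
    using n by (intro triple_wp) (auto simp: support_inv_def)
  show "triple ?A (count_loop 10 0
       (Cond (Minus (Read 6 (Read 7 (var 10))) (Read 6 (var 11)))
         (Assign 11 (Num 0) (Read 7 (var 10))) Skip)) (n * (4 + 1) + 2) (leader_inv n)"
  proof (rule triple_count_loop[where I = leader_inv])
    fix k assume k: "k < n"
    show "triple (leader_inv k) (Seq (Assign 10 (Num 0) (Plus (var 10) (Num 1)))
       (Cond (Minus (Read 6 (Read 7 (var 10))) (Read 6 (var 11)))
         (Assign 11 (Num 0) (Read 7 (var 10))) Skip)) 4 (leader_inv (Suc k))"
    proof (rule triple_wp)
      fix s assume s: "leader_inv k s"
      \<comment> \<open>The support cell of the current leader is known only because the leader is
        some voter's first choice.\<close>
      obtain i where i: "i \<in> {1..n}" "leader n (f (Suc J)) (budget n T f J) k = f (Suc J) i"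
        using leader_mem[OF n, of k "f (Suc J)" "budget n T f J"] k by auto
      with s k show "wp (Seq (Assign 10 (Num 0) (Plus (var 10) (Num 1)))
         (Cond (Minus (Read 6 (Read 7 (var 10))) (Read 6 (var 11)))
           (Assign 11 (Num 0) (Read 7 (var 10))) Skip)) (leader_inv (Suc k)) s"
        by (auto simp: leader_inv_def envD)
    qed simp
  qed (auto simp: leader_inv_def support_inv_def envD)
qed

lemma charge_supporters:
  "triple (leader_inv n) charge_supporters (2 + (n * (6 + 1) + 2)) (charge_inv n)"
  unfolding charge_supporters_def
proof (rule triple_seq)
  show "triple (leader_inv n) (Seq (Assign 4 (var 8) (var 11)) (Assign 12 (Num 0) (var 0))) 2
    (\<lambda>s. charge_inv 0 (s(10 := (s 10)(0 := 0))))"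
    by (intro triple_wp) (auto simp: leader_inv_def charge_inv_def env_def greedy_def le_Suc_eq)
  show "triple (\<lambda>s. charge_inv 0 (s(10 := (s 10)(0 := 0)))) (count_loop 10 0
       (Cond (Plus (Minus (Read 7 (var 10)) (var 11)) (Minus (var 11) (Read 7 (var 10))))
         Skip
         (Seq (Assign 13 (Num 0) (Read 5 (var 10)))
         (Seq (Assign 5 (var 10) (Minus (Read 5 (var 10)) (var 12)))
              (Assign 12 (Num 0) (Minus (var 12) (var 13))))))) (n * (6 + 1) + 2) (charge_inv n)"
  proof (rule triple_count_loop[where I = charge_inv])
    fix k assume k: "k < n"
    show "triple (charge_inv k) (Seq (Assign 10 (Num 0) (Plus (var 10) (Num 1)))
       (Cond (Plus (Minus (Read 7 (var 10)) (var 11)) (Minus (var 11) (Read 7 (var 10))))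
         Skip
         (Seq (Assign 13 (Num 0) (Read 5 (var 10)))
         (Seq (Assign 5 (var 10) (Minus (Read 5 (var 10)) (var 12)))
              (Assign 12 (Num 0) (Minus (var 12) (var 13))))))) 6 (charge_inv (Suc k))"
    proof (rule triple_wp)
      fix s assume "charge_inv k s"
      then have s: "env (Suc J) (Suc J * n * m) (Suc J) s" "s 10 0 = k" "s 11 0 = greedy n T f (Suc J)"
          "s 12 0 = n - support k (f (Suc J)) (budget n T f J) (greedy n T f (Suc J))"
        and s5: "i \<in> {1..n} \<Longrightarrow>
          s 5 i = (if i \<le> k then budget n T f (Suc J) i else budget n T f J i)"
        and s7: "i \<in> {1..n} \<Longrightarrow> s 7 i = f (Suc J) i" for i
        by (auto simp: charge_inv_def)
      have Suc_k: "s 5 (Suc k) = budget n T f J (Suc k)" "s 7 (Suc k) = f (Suc J) (Suc k)"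
        using s5[of "Suc k"] s7[of "Suc k"] k by auto
      show "wp (Seq (Assign 10 (Num 0) (Plus (var 10) (Num 1)))
         (Cond (Plus (Minus (Read 7 (var 10)) (var 11)) (Minus (var 11) (Read 7 (var 10))))
           Skip
           (Seq (Assign 13 (Num 0) (Read 5 (var 10)))
           (Seq (Assign 5 (var 10) (Minus (Read 5 (var 10)) (var 12)))
                (Assign 12 (Num 0) (Minus (var 12) (var 13))))))) (charge_inv (Suc k)) s"
      proof (cases "f (Suc J) (Suc k) = greedy n T f (Suc J)")
        case True
        then show ?thesis
          using s Suc_k s5 s7 by (simp add: charge_inv_def budget_Suc charge_def le_Suc_eq)
      next
        case False
        then have "f (Suc J) (Suc k) - greedy n T f (Suc J) + (greedy n T f (Suc J) - f (Suc J) (Suc k)) \<noteq> 0"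
          by linarith
        with False show ?thesis
          using s Suc_k s5 s7
          by (simp add: charge_inv_def budget_Suc charge_def le_Suc_eq del: add_is_0)
      qed
    qed simp
  qed (auto simp: charge_inv_def envD)
qed

text \<open>The parts cost \<open>20 * n + 12\<close> in total, which is at most
  \<open>32 * n\<close> because \<open>n \<ge> 1\<close>.\<close>

lemma round:
  "triple (round_start J) (Seq (Assign 8 (Num 0) (Plus (var 8) (Num 1)))
     (Seq read_firsts (Seq add_support (Seq find_leader charge_supporters)))) (32 * n)
     (round_start (Suc J))"
proof (rule triple_weaken)
  have "triple (round_start J) (Assign 8 (Num 0) (Plus (var 8) (Num 1))) 1
    (\<lambda>s. env (Suc J) (J * n * m) J s \<and> (\<forall>i\<in>{1..n}. s 5 i = budget n T f J i))"
    by (intro triple_wp) (auto simp: round_start_def env_def)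
  from triple_seq[OF this triple_seq[OF read_firsts triple_seq[OF add_support
        triple_seq[OF find_leader charge_supporters]]]]
  show "triple (round_start J) (Seq (Assign 8 (Num 0) (Plus (var 8) (Num 1)))
     (Seq read_firsts (Seq add_support (Seq find_leader charge_supporters))))
     (1 + ((n * (4 + 1) + 2) + ((n * (2 + 1) + 2) + ((1 + (n * (4 + 1) + 2)) + (2 + (n * (6 + 1) + 2))))))
     (charge_inv n)" .
qed (use n in \<open>auto simp: charge_inv_def round_start_def\<close>)

end

lemma greedy_program:
  assumes "s 0 0 = n" "s 1 0 = m" "s 2 0 = T" "s 3 = tab" "s 8 0 = 0" "s 9 0 = 0"
  shows "\<exists>u s'. exec greedy_program s u s' \<and> u \<le> 40 * (n * T) \<and> (\<forall>j\<in>{1..T}. s' 4 j = greedy n T f j)"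
proof -
  let ?I = "\<lambda>k s. env 0 0 0 s \<and> s 10 0 = k \<and> (\<forall>i\<in>{1..k}. s 5 i = T)"
  have "triple (env 0 0 0) (count_loop 10 0 (Assign 5 (var 10) (var 2))) (n * (2 + 1) + 2) (?I n)"
  proof (rule triple_count_loop[where I = ?I])
    fix k assume "k < n"
    show "triple (?I k) (Seq (Assign 10 (Num 0) (Plus (var 10) (Num 1))) (Assign 5 (var 10) (var 2)))
      2 (?I (Suc k))"
      by (intro triple_wp) (auto simp: envD le_Suc_eq)
  qed (auto simp: envD)
  moreover have "triple (?I n)
     (count_loop 8 2 (Seq read_firsts (Seq add_support (Seq find_leader charge_supporters))))
     (T * (32 * n + 1) + 2) (round_start T)"
    by (rule triple_count_loop[where I = round_start, OF _ round]) (auto simp: round_start_def env_def)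
  ultimately have "triple (env 0 0 0) greedy_program
      ((n * (2 + 1) + 2) + (T * (32 * n + 1) + 2)) (round_start T)"
    unfolding greedy_program_def by (rule triple_seq)
  moreover have "env 0 0 0 s" using assms by (simp add: env_def)
  ultimately obtain u s' where "exec greedy_program s u s'"
    "u \<le> (n * (2 + 1) + 2) + (T * (32 * n + 1) + 2)" "round_start T s'"
    unfolding triple_def by blast
  moreover have "(n * (2 + 1) + 2) + (T * (32 * n + 1) + 2) \<le> 40 * (n * T)"
  proof -
    have "(n * (2 + 1) + 2) + (T * (32 * n + 1) + 2) = 32 * (n * T) + T + 3 * n + 4"
      by (simp add: algebra_simps)
    moreover have "n \<le> n * T" "T \<le> n * T" "1 \<le> n * T" using n T by simp_all
    ultimately show ?thesis by linarith
  qed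
  moreover have "\<forall>j\<in>{1..T}. s' 4 j = greedy n T f j" if "round_start T s'"
    using that by (simp add: round_start_def env_def)
  ultimately show ?thesis using order_trans by blast
qed

end

section \<open>Positions in the ranking table\<close>

lemma length_concat_const: "(\<And>xs. xs \<in> set xss \<Longrightarrow> length xs = l) \<Longrightarrow> length (concat xss) = length xss * l"
  by (induction xss) auto

lemma nth_concat_const:
  "(\<And>xs. xs \<in> set xss \<Longrightarrow> length xs = l) \<Longrightarrow> a < length xss \<Longrightarrow> b < l \<Longrightarrow>
    concat xss ! (a * l + b) = xss ! a ! b"
proof (induction xss arbitrary: a)
  case (Cons xs xss)
  then show ?case by (cases a) (auto simp: nth_append)
qed simp

text \<open>This yields the assumption \<open>tab\<close> of \<open>greedy_run\<close>. The bound on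
  the position is included because \<open>input_store\<close> is 0 beyond the table.\<close>

lemma ranking_table:
  assumes P: "is_profile n C T P"
  shows "length (ranking_table n T P) = T * (n * card C)"
    and "j < T \<Longrightarrow> k < n \<Longrightarrow> (j * n + k) * card C < T * (n * card C) \<and>
      ranking_table n T P ! ((j * n + k) * card C) = hd (P (Suc j) (Suc k))"
proof -
  have len: "length (P j i) = card C" if "j \<in> {1..T}" "i \<in> {1..n}" for j i
    using P that by (intro length_finite_permutations_of_set) (auto simp: is_profile_def)
  have C: "card C > 0" using P by (auto simp: is_profile_def card_gt_0_iff)
  let ?row = "\<lambda>j. concat (map (\<lambda>i. P j i) [1..<n + 1])"
  have row: "length (?row j) = n * card C" if "j \<in> {1..T}" for j
    using that len by (subst length_concat_const[where l = "card C"]) auto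
  then show "length (ranking_table n T P) = T * (n * card C)"
    unfolding ranking_table_def by (subst length_concat_const[where l = "n * card C"]) auto
  assume j: "j < T" and k: "k < n"
  have "k * card C < n * card C" using k C by simp
  then have "ranking_table n T P ! (j * (n * card C) + k * card C) = ?row (Suc j) ! (k * card C)"
    unfolding ranking_table_def using row j
    by (subst nth_concat_const) (auto simp del: upt_Suc)
  \<comment> \<open>The head is entry 0 of its block; the explicit offset fits
    \<open>nth_concat_const\<close>.\<close>
  also have "\<dots> = ?row (Suc j) ! (k * card C + 0)" by simp
  also have "\<dots> = P (Suc j) (Suc k) ! 0"
    using j k len C by (subst nth_concat_const[where l = "card C"]) (auto simp del: upt_Suc)
  also have "\<dots> = hd (P (Suc j) (Suc k))"
    using len[of "Suc j" "Suc k"] j k C by (intro hd_conv_nth[symmetric]) auto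
  finally have "ranking_table n T P ! ((j * n + k) * card C) = hd (P (Suc j) (Suc k))"
    by (simp add: algebra_simps)
  moreover have "(j * n + k) * card C < T * (n * card C)"
  proof -
    have "j * n + k < Suc j * n" using k by simp
    also have "\<dots> \<le> T * n" using j by (intro mult_right_mono) auto
    finally show ?thesis using C by (simp flip: mult.assoc)
  qed
  ultimately show "(j * n + k) * card C < T * (n * card C) \<and>
      ranking_table n T P ! ((j * n + k) * card C) = hd (P (Suc j) (Suc k))" by blast
qed

text \<open>One table entry per voter and round is read, so the time is linear in
  \<open>n * T\<close>, and \<open>card C \<ge> 1\<close>.\<close>

lemma polynomial_time_greedy_rule: "polynomial_time greedy_rule"
  unfolding polynomial_time_def
proof (rule exI[of _ greedy_program], rule exI[of _ 40], rule exI[of _ 1], intro allI impI)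
  fix n T :: nat and C :: "nat set" and P :: "nat profile"
  assume P: "is_profile n C T P"
  let ?s = "input_store n C T P"
  interpret greedy_run n "card C" T "?s 3" "\<lambda>j i. hd (P j i)"
  proof
    fix j k assume "j < T" "k < n"
    then show "?s 3 ((j * n + k) * card C) = hd (P (Suc j) (Suc k))"
      using ranking_table[OF P] by (simp add: input_store_def)
  qed (use P in \<open>auto simp: is_profile_def\<close>)
  have "card C \<ge> 1" using P by (auto simp: is_profile_def card_gt_0_iff Suc_le_eq)
  then have le: "40 * (n * T) \<le> 40 * (n * card C * T) ^ 1" by simp
  obtain t s where "exec greedy_program ?s t s" "t \<le> 40 * (n * T)"
    "\<forall>j\<in>{1..T}. s 4 j = greedy n T (\<lambda>j i. hd (P j i)) j"
    using greedy_program[of ?s] by (auto simp: input_store_def)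
  with order_trans[OF _ le] show "\<exists>t s. exec greedy_program ?s t s \<and> t \<le> 40 * (n * card C * T) ^ 1 \<and>
      (\<forall>j\<in>{1..T}. s 4 j = greedy_rule n C T P j)"
    unfolding greedy_rule_def by blast
qed

section \<open>Cyclic profiles\<close>

definition cyc :: "nat \<Rightarrow> nat list" where
  "cyc t = map (\<lambda>k. (t + k) mod 4) [0..<4]"

text \<open>Voters 1, 2, 3 each have their own type; among \<open>2 * T \<ge> 4\<close> voters the
  remaining \<open>2 * T - 3\<close> have type 0.\<close>

definition voter_type :: "nat \<Rightarrow> nat" where
  "voter_type i = (if i < 4 then i else 0)"

definition cyclic_profile :: "nat profile" where
  "cyclic_profile j i = cyc (voter_type i)"

lemma voter_type_less: "voter_type i < 4"
  by (simp add: voter_type_def)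

lemma less_4_cases: "(t::nat) < 4 \<longleftrightarrow> t = 0 \<or> t = 1 \<or> t = 2 \<or> t = 3"
  by auto

lemma cyc_permutation: "t < 4 \<Longrightarrow> cyc t \<in> permutations_of_set {0, 1, 2, 3}"
  unfolding less_4_cases permutations_of_set_def cyc_def
  by (auto simp: upt_rec)

text \<open>Every type other than \<open>w\<close> prefers the cyclic predecessor \<open>w + 3\<close> of \<open>w\<close> to \<open>w\<close>.\<close>

lemma cyc_dominated:
  assumes "t < 4" "w < 4" "t \<noteq> w"
  defines "r \<equiv> (w + 4 - t) mod 4"
  shows "r \<in> {1..4}" "(w + 3) mod 4 \<in> set (take r (cyc t))" "w \<notin> set (take r (cyc t))"
  using assms unfolding less_4_cases cyc_def by (auto simp: upt_rec)

lemma hd_cyc: "t < 4 \<Longrightarrow> hd (cyc t) = t"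
  by (auto simp: cyc_def upt_rec)

lemma cyclic_profile:
  assumes "T \<ge> 1"
  shows "is_profile (2 * T) {0, 1, 2, 3} T cyclic_profile"
    "static (2 * T) T cyclic_profile"
    "at_most_first_choices 4 (2 * T) T cyclic_profile"
proof -
  show "is_profile (2 * T) {0, 1, 2, 3} T cyclic_profile"
    using assms cyc_permutation[OF voter_type_less] by (auto simp: is_profile_def cyclic_profile_def)
  show "static (2 * T) T cyclic_profile"
    by (simp add: static_def cyclic_profile_def)
  show "at_most_first_choices 4 (2 * T) T cyclic_profile"
    unfolding at_most_first_choices_def
  proof
    fix j
    have "first_choices (2 * T) cyclic_profile j \<subseteq> {..<4}"
      using voter_type_less by (auto simp: first_choices_def cyclic_profile_def hd_cyc)
    then show "card (first_choices (2 * T) cyclic_profile j) \<le> 4"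
      using card_mono[of "{..<4::nat}"] by simp
  qed
qed

text \<open>A union of types can be made to agree in every round while being represented only when
  the winner is in \<open>X\<close>. With \<open>2 * T\<close> voters its quota is half its size,
  rounded down.\<close>

lemma wPJR_cyclic_profile:
  assumes W: "W \<in> sequences {0, 1, 2, 3} T" and T: "T \<ge> 1"
    and PJR: "all_rank_wPJR (2 * T) {0, 1, 2, 3} T cyclic_profile W"
  shows "card {i \<in> {1..2 * T}. voter_type i \<in> X} div 2 \<le> card {j \<in> {1..T}. W j \<in> X}"
proof (cases "{i \<in> {1..2 * T}. voter_type i \<in> X} = {}")
  case ne: False
  let ?S = "{i \<in> {1..2 * T}. voter_type i \<in> X}"
  \<comment> \<open>For \<open>W j\<close> outside \<open>X\<close>, each ranking is cut just above
    \<open>W j\<close>: the rank is the 0-based position of \<open>W j\<close> in the ranking. For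
    \<open>W j\<close> in \<open>X\<close>, rank 4 admits all candidates.\<close>
  define R where "R j i = (if W j \<in> X then 4 else (W j + 4 - voter_type i) mod 4)" for j i
  have W4: "W j < 4" if "j \<in> {1..T}" for j using W that unfolding sequences_def less_4_cases by blast
  \<comment> \<open>Outside the group, a voter of type \<open>W j\<close> could get rank 0 from
    \<open>R\<close>, which is not a legal rank; 4 is used there.\<close>
  let ?R' = "\<lambda>j i. if i \<in> ?S then R j i else 4"
  have rm: "?R' \<in> rank_matrices (2 * T) (card {0, 1, 2, 3 :: nat}) T"
    unfolding rank_matrices_def
  proof (intro CollectI ballI)
    fix j i assume j: "j \<in> {1..T}"
    show "?R' j i \<in> {1..card {0, 1, 2, 3 :: nat}}"
    proof (cases "i \<in> ?S \<and> W j \<notin> X")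
      case True
      then have "voter_type i \<noteq> W j" by auto
      from cyc_dominated(1)[OF voter_type_less W4[OF j] this] True
      show ?thesis by (simp add: R_def)
    qed (auto simp: R_def)
  qed
  have ag: "agrees cyclic_profile ?R' ?S j" if j: "j \<in> {1..T}" for j
  proof -
    have "(W j + 3) mod 4 \<in> top_set cyclic_profile j i (?R' j i)" if i: "i \<in> ?S" for i
    proof (cases "W j \<in> X")
      case True
      have "set (take 4 (cyc (voter_type i))) = {0, 1, 2, 3}"
        using cyc_permutation[OF voter_type_less, of i]
        by (auto simp: permutations_of_set_def cyc_def)
      then show ?thesis using True i by (auto simp: top_set_def cyclic_profile_def R_def)
    next
      case False
      then have "voter_type i \<noteq> W j" using i by auto
      then show ?thesis
        using cyc_dominated(2)[OF voter_type_less W4[OF j], of i] False i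
        by (simp add: top_set_def cyclic_profile_def R_def)
    qed
    then show ?thesis unfolding agrees_def by blast
  qed
  have "T * card ?S div (2 * T) \<le> card {j \<in> {1..T}. represented cyclic_profile ?R' W ?S j}"
    using PJR[unfolded all_rank_wPJR_def, rule_format, OF rm ne] ag by blast
  also have "\<dots> \<le> card {j \<in> {1..T}. W j \<in> X}"
  proof (intro card_mono subsetI)
    fix j assume "j \<in> {j \<in> {1..T}. represented cyclic_profile ?R' W ?S j}"
    then obtain i where j: "j \<in> {1..T}" and i: "i \<in> ?S" "W j \<in> top_set cyclic_profile j i (R j i)"
      by (auto simp: represented_def)
    have "W j \<in> X"
    proof (rule ccontr)
      assume "W j \<notin> X"
      moreover from this have "voter_type i \<noteq> W j" using i by auto
      ultimately show False
        using cyc_dominated(3)[OF voter_type_less W4[OF j], of i] i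
        by (simp add: top_set_def cyclic_profile_def R_def)
    qed
    with j show "j \<in> {j \<in> {1..T}. W j \<in> X}" by simp
  qed simp
  finally show ?thesis using T by simp
qed (simp only: card.empty div_0 zero_le)

lemma no_wPJR_cyclic_profile:
  assumes W: "W \<in> sequences {0, 1, 2, 3} T" and T: "T \<ge> 2"
  shows "\<not> all_rank_wPJR (2 * T) {0, 1, 2, 3} T cyclic_profile W"
proof
  assume PJR: "all_rank_wPJR (2 * T) {0, 1, 2, 3} T cyclic_profile W"
  define t where "t c = card {j \<in> {1..T}. W j = c}" for c
  have t2: "card {j \<in> {1..T}. W j \<in> {x, y}} = t x + t y" if "x \<noteq> y" for x y
    unfolding t_def using that
    by (subst card_Un_disjoint[symmetric]) (auto intro: arg_cong[where f = card])
  have "{1..T} = {j \<in> {1..T}. W j \<in> {0, 1}} \<union> {j \<in> {1..T}. W j \<in> {2, 3}}"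
    using W by (auto simp: sequences_def)
  then have "T = card ({j \<in> {1..T}. W j \<in> {0, 1}} \<union> {j \<in> {1..T}. W j \<in> {2, 3}})"
    by (metis card_atLeastAtMost diff_Suc_1)
  then have total: "T = t 0 + t 1 + t 2 + t 3"
    using t2[of 0 1] t2[of 2 3] by (subst (asm) card_Un_disjoint) auto
  \<comment> \<open>Two voters have these types, so their quota is 1.\<close>
  have single: "1 \<le> t x + t y" if "x \<in> {1, 2, 3}" "y \<in> {1, 2, 3}" "x \<noteq> y" for x y
  proof -
    have "{i \<in> {1..2 * T}. voter_type i \<in> {x, y}} = {x, y}"
      using that T by (auto simp: voter_type_def)
    with wPJR_cyclic_profile[OF W _ PJR, of "{x, y}"] T that
    have "1 \<le> card {j \<in> {1..T}. W j \<in> {x, y}}" by simp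
    with t2[OF that(3)] show ?thesis by simp
  qed
  \<comment> \<open>All but two voters have these types, so their quota is
    \<open>T - 1\<close>.\<close>
  have large: "T - 1 \<le> t 0 + t x" if "x \<in> {1, 2, 3}" for x
  proof -
    have "{i \<in> {1..2 * T}. voter_type i \<in> {0, x}} = {1..2 * T} - ({1, 2, 3} - {x})"
      using that T by (auto simp: voter_type_def)
    moreover have "card ({1..2 * T} - ({1, 2, 3} - {x})) = 2 * T - 2"
      using T that by (subst card_Diff_subset) auto
    ultimately have "T - 1 \<le> card {j \<in> {1..T}. W j \<in> {0, x}}"
      using wPJR_cyclic_profile[OF W _ PJR, of "{0, x}"] T by auto
    with t2[of 0 x] that show ?thesis by auto
  qed
  \<comment> \<open>By \<open>large\<close> and \<open>total\<close> each of these sums is at most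
    1, and by \<open>single\<close> at least 1. Adding the three equations equates an even number
    with 3.\<close>
  have "t 2 + t 3 = 1" "t 1 + t 3 = 1" "t 1 + t 2 = 1"
    using single[of 1 2] single[of 1 3] single[of 2 3] large[of 1] large[of 2] large[of 3] total
    by simp_all
  then show False by arith
qed

section \<open>The characterization for both axioms\<close>

theorem corollary5p2:
  shows
    "(\<forall>d\<ge>1. \<forall>T\<ge>1.
        (\<forall>n (C :: nat set) P. is_profile n C T P \<and> at_most_first_choices d n T P \<longrightarrow>
           (\<exists>W\<in>sequences C T. all_rank_PJR n C T P W))
        \<longleftrightarrow> T = 1 \<or> d \<le> 3)
   \<and> (\<forall>d\<ge>1. \<forall>T\<ge>1.
        (\<forall>n (C :: nat set) P. is_profile n C T P \<and> at_most_first_choices d n T P \<longrightarrow>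
           (\<exists>W\<in>sequences C T. all_rank_wPJR n C T P W))
        \<longleftrightarrow> T = 1 \<or> d \<le> 3)
   \<and> (\<exists>F :: nat rule. is_rule F \<and> semi_online F \<and> polynomial_time F \<and>
        (\<forall>d\<ge>1. \<forall>T\<ge>1. T = 1 \<or> d \<le> 3 \<longrightarrow>
           (\<forall>n C P. is_profile n C T P \<and> at_most_first_choices d n T P \<longrightarrow>
              all_rank_PJR n C T P (F n C T P) \<and> all_rank_wPJR n C T P (F n C T P))))
   \<and> (\<forall>T\<ge>2. \<exists>(C :: nat set) P. card C = 4 \<and> is_profile (2 * T) C T P \<and> static (2 * T) T P \<and>
        at_most_first_choices 4 (2 * T) T P \<and>
        \<not> (\<exists>W\<in>sequences C T. all_rank_wPJR (2 * T) C T P W))"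
proof (intro conjI)
  have neg: "\<exists>(C :: nat set) P. card C = 4 \<and> is_profile (2 * T) C T P \<and> static (2 * T) T P \<and>
        at_most_first_choices 4 (2 * T) T P \<and>
        \<not> (\<exists>W\<in>sequences C T. all_rank_wPJR (2 * T) C T P W)" if "T \<ge> 2" for T
    using cyclic_profile[of T] no_wPJR_cyclic_profile[OF _ that] that
    by (intro exI[of _ "{0, 1, 2, 3}"] exI[of _ cyclic_profile]) auto
  then show "\<forall>T\<ge>2. \<exists>(C :: nat set) P. card C = 4 \<and> is_profile (2 * T) C T P \<and> static (2 * T) T P \<and>
        at_most_first_choices 4 (2 * T) T P \<and>
        \<not> (\<exists>W\<in>sequences C T. all_rank_wPJR (2 * T) C T P W)" by blast
  have T1: "T \<ge> 1" if "is_profile n C T P" for n C T and P :: "nat profile"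
    using that by (simp add: is_profile_def)
  have pos: "all_rank_PJR n C T P (greedy_rule n C T P) \<and> all_rank_wPJR n C T P (greedy_rule n C T P)"
    if "T = 1 \<or> d \<le> 3" "is_profile n C T P \<and> at_most_first_choices d n T P"
    for d n T C and P :: "nat profile"
    using that greedy_rule_PJR all_rank_PJR_imp_wPJR T1 by blast
  then show "\<exists>F :: nat rule. is_rule F \<and> semi_online F \<and> polynomial_time F \<and>
        (\<forall>d\<ge>1. \<forall>T\<ge>1. T = 1 \<or> d \<le> 3 \<longrightarrow>
           (\<forall>n C P. is_profile n C T P \<and> at_most_first_choices d n T P \<longrightarrow>
              all_rank_PJR n C T P (F n C T P) \<and> all_rank_wPJR n C T P (F n C T P)))"
    using is_rule_greedy_rule semi_online_greedy_rule polynomial_time_greedy_rule by blast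
  have mem: "greedy_rule n C T P \<in> sequences C T" if "is_profile n C T P" for n C T and P :: "nat profile"
    using is_rule_greedy_rule that unfolding is_rule_def by blast
  \<comment> \<open>\<open>Q\<close> stands for any axiom between all-rank-wPJR and all-rank-PJR, so
    one argument serves both equivalences.\<close>
  have char: "(\<forall>n (C :: nat set) P. is_profile n C T P \<and> at_most_first_choices d n T P \<longrightarrow>
           (\<exists>W\<in>sequences C T. Q n C T P W)) \<longleftrightarrow> T = 1 \<or> d \<le> 3"
    if T: "T \<ge> 1" and
      Q_pos: "\<And>n C T P W. T \<ge> 1 \<Longrightarrow> all_rank_PJR n C T P W \<Longrightarrow> Q n C T P W" and
      Q_neg: "\<And>n C T P W. T \<ge> 1 \<Longrightarrow> Q n C T P W \<Longrightarrow> all_rank_wPJR n C T P W"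
    for d T and Q :: "nat \<Rightarrow> nat set \<Rightarrow> nat \<Rightarrow> nat profile \<Rightarrow> (nat \<Rightarrow> nat) \<Rightarrow> bool"
  proof
    assume Td: "T = 1 \<or> d \<le> 3"
    show "\<forall>n C P. is_profile n C T P \<and> at_most_first_choices d n T P \<longrightarrow>
        (\<exists>W\<in>sequences C T. Q n C T P W)"
    proof (intro allI impI)
      fix n C and P :: "nat profile" assume "is_profile n C T P \<and> at_most_first_choices d n T P"
      from Q_pos[OF T conjunct1[OF pos[OF Td this]]] mem[OF conjunct1[OF this]]
      show "\<exists>W\<in>sequences C T. Q n C T P W" by blast
    qed
  next
    assume *: "\<forall>n C P. is_profile n C T P \<and> at_most_first_choices d n T P \<longrightarrow>
        (\<exists>W\<in>sequences C T. Q n C T P W)"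
    show "T = 1 \<or> d \<le> 3"
    proof (rule ccontr)
      assume "\<not> (T = 1 \<or> d \<le> 3)"
      then have "T \<ge> 2" "d \<ge> 4" using T by auto
      from neg[OF this(1)] obtain C :: "nat set" and P where C: "is_profile (2 * T) C T P"
        "at_most_first_choices 4 (2 * T) T P" "\<not> (\<exists>W\<in>sequences C T. all_rank_wPJR (2 * T) C T P W)"
        by blast
      \<comment> \<open>The counterexample with four first choices serves every
        \<open>d \<ge> 4\<close>.\<close>
      have "at_most_first_choices d (2 * T) T P"
        using C(2) \<open>d \<ge> 4\<close> unfolding at_most_first_choices_def by (meson order_trans)
      with * C(1) obtain W where "W \<in> sequences C T" "Q (2 * T) C T P W" by blast
      with C(3) Q_neg[OF T] show False by blast
    qed
  qed
  show "\<forall>d\<ge>1. \<forall>T\<ge>1.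
        (\<forall>n (C :: nat set) P. is_profile n C T P \<and> at_most_first_choices d n T P \<longrightarrow>
           (\<exists>W\<in>sequences C T. all_rank_PJR n C T P W)) \<longleftrightarrow> T = 1 \<or> d \<le> 3"
    by (intro allI impI char) (auto intro: all_rank_PJR_imp_wPJR)
  show "\<forall>d\<ge>1. \<forall>T\<ge>1.
        (\<forall>n (C :: nat set) P. is_profile n C T P \<and> at_most_first_choices d n T P \<longrightarrow>
           (\<exists>W\<in>sequences C T. all_rank_wPJR n C T P W)) \<longleftrightarrow> T = 1 \<or> d \<le> 3"
    by (intro allI impI char) (auto intro: all_rank_PJR_imp_wPJR)
qed

end
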